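(* Let $d\ge 2$ be an integer. For every integer $\ell\ge 1$ and every $x\in[-1,1]$, $$P_{2\ell}(x)-P_{2(\ell+1)}(x)\le\frac{\lambda_{2(\ell+1)}-\lambda_{2\ell}}{\lambda_2}\,\bigl(1-P_2(x)\bigr),$$ where $P_k$ denotes the Legendre polynomial of order $k$ in dimension $d$ (associated with the sphere $\mathbb{S}^{d-1}$), normalized by $P_k(1)=1$, and $\lambda_k=k(k+d-2)$.
   Context: Let $\mathbb{S}^{d-1}$ be the unit sphere of $\mathbb{R}^d$ and let $e_1\in\mathbb{S}^{d-1}$ be the first standard basis vector. A spherical harmonic of order $k$ is the restriction to $\mathbb{S}^{d-1}$ of a homogeneous harmonic polynomial of degree $k$ on $\mathbb{R}^d$; it is an eigenfunction of the (minus) spherical Laplacian $-\Delta_{\mathbb{S}^{d-1}}$ with eigenvalue $\lambda_k=k(k+d-2)$. The Legendre polynomial $P_k$ of order $k$ (in dimension $d$) is the polynomial in one real variable, normalized so that $P_k(1)=1$, such that $Y_k(\sigma)=P_k(e_1\cdot\sigma)$, $\sigma\in\mathbb{S}^{d-1}$, is the unique axially symmetric spherical harmonic of order $k$ with $Y_k(e_1)=1$. Axially symmetric means invariant under all orthogonal transformations of $\mathbb{R}^d$ fixing $e_1$. For $d=2$ this gives $P_k(\cos\Theta)=\cos(k\Theta)$ for $\Theta\in[0,\pi]$. *)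

theory Defs
  imports "HOL-Analysis.Analysis" "HOL-Computational_Algebra.Polynomial"
begin

definition laplacian :: "(real ^ 'n \<Rightarrow> real) \<Rightarrow> real ^ 'n \<Rightarrow> real" where
  "laplacian f x = (\<Sum>j\<in>UNIV. (deriv ^^ 2) (\<lambda>t. f (x + t *\<^sub>R axis j 1)) 0)"

definition homogeneous_harmonic_polynomial :: "nat \<Rightarrow> (real ^ 'n \<Rightarrow> real) \<Rightarrow> bool" where
  "homogeneous_harmonic_polynomial k p \<longleftrightarrow>
     real_polynomial_function p \<and>
     (\<forall>c x. p (c *\<^sub>R x) = c ^ k * p x) \<and>
     (\<forall>x. laplacian p x = 0)"

text \<open>Functions on the unit sphere are total functions on the ambient space of which only the
  values on \<^term>\<open>sphere 0 1\<close> matter.\<close>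

definition spherical_harmonic :: "nat \<Rightarrow> (real ^ 'n \<Rightarrow> real) \<Rightarrow> bool" where
  "spherical_harmonic k Y \<longleftrightarrow>
     (\<exists>p. homogeneous_harmonic_polynomial k p \<and> (\<forall>\<sigma>\<in>sphere 0 1. Y \<sigma> = p \<sigma>))"

definition axially_symmetric :: "real ^ 'n \<Rightarrow> (real ^ 'n \<Rightarrow> real) \<Rightarrow> bool" where
  "axially_symmetric e Y \<longleftrightarrow>
     (\<forall>T. orthogonal_transformation T \<and> T e = e \<longrightarrow> (\<forall>\<sigma>\<in>sphere 0 1. Y (T \<sigma>) = Y \<sigma>))"

text \<open>The dimension \<open>d\<close> is \<^term>\<open>CARD('n)\<close>. The index \<open>i\<close> plays the role of the first
  coordinate: index types carry no order, and by rotation invariance the polynomial does not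
  depend on \<open>i\<close>. For \<open>d \<ge> 2\<close> the values \<open>axis i 1 \<bullet> \<sigma>\<close> fill the interval from \<open>-1\<close>
  to \<open>1\<close>, so the polynomial is determined by the function on the sphere.\<close>

definition legendre_poly :: "'n::finite \<Rightarrow> nat \<Rightarrow> real poly" where
  "legendre_poly i k =
     (THE P. poly P 1 = 1 \<and>
        spherical_harmonic k (\<lambda>\<sigma>. poly P (axis i 1 \<bullet> \<sigma>)) \<and>
        axially_symmetric (axis i 1) (\<lambda>\<sigma>. poly P (axis i 1 \<bullet> \<sigma>)))"

definition sphere_eigenvalue :: "nat \<Rightarrow> nat \<Rightarrow> real" where
  "sphere_eigenvalue d k = real k * (real k + real d - 2)"

end

(*
  Write d for the dimension. A polynomial P is a Legendre polynomial of order k exactly when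
  |x|^k P(x_i/|x|) is harmonic, and computing its Laplacian on the sphere gives the Gegenbauer
  equation (1 - x^2) P'' - (d - 1) x P' + k (k + d - 2) P = 0. Polynomial solutions of it are
  determined by P(1), because P(1) determines P'(1) and P' solves the equation with d + 2 in place
  of d. Hence P_k is given by the classical three-term recurrence, whose homogeneous version yields
  a harmonic polynomial. With m = k + 1 the recurrence gives
    P_k - P_(k+2) = (2k + d) / (m (m + d - 2)) (1 - x^2) P_m',
  and 1 - P_2 = d / (d - 1) (1 - x^2), so the claim becomes P_m'(x) <= P_m'(1). This is Sonin's
  bound for the Gegenbauer equation solved by P_m'; by parity only x >= 0 is needed.
*)

theory Submission
  imports Defs
begin

section \<open>Polynomial solutions of the Gegenbauer equation\<close>

text \<open>An identity of polynomials, not of values, so that \<open>pderiv\<close> can be applied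
  to it. Dimension d and order k correspond to \<open>a\<close> = d - 1 and \<open>lam\<close> = k
  (k + d - 2); both stay free because differentiation shifts them.\<close>

definition gegenbauer_ode :: "real \<Rightarrow> real \<Rightarrow> real poly \<Rightarrow> bool" where
  "gegenbauer_ode a lam P \<longleftrightarrow>
     [:1, 0, -1:] * pderiv (pderiv P) - smult a ([:0, 1:] * pderiv P) + smult lam P = 0"

lemma gegenbauer_ode_poly:
  "gegenbauer_ode a lam P \<Longrightarrow>
    (1 - x\<^sup>2) * poly (pderiv (pderiv P)) x - a * x * poly (pderiv P) x + lam * poly P x = 0"
  unfolding gegenbauer_ode_def
  by (drule arg_cong[where f = "\<lambda>p. poly p x"]) (simp add: algebra_simps power2_eq_square)

lemma gegenbauer_ode_pderiv:
  assumes "gegenbauer_ode a lam P"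
  shows "gegenbauer_ode (a + 2) (lam - a) (pderiv P)"
proof -
  have "pderiv ([:1, 0, -1:] * pderiv (pderiv P) - smult a ([:0, 1:] * pderiv P) + smult lam P) = 0"
    using assms unfolding gegenbauer_ode_def by simp
  then have "poly (pderiv ([:1, 0, -1:] * pderiv (pderiv P) - smult a ([:0, 1:] * pderiv P)
      + smult lam P)) x = 0" for x
    by simp
  then have "poly ([:1, 0, -1:] * pderiv (pderiv (pderiv P))
      - smult (a + 2) ([:0, 1:] * pderiv (pderiv P)) + smult (lam - a) (pderiv P)) x = 0" for x
    by (simp add: pderiv_mult pderiv_add pderiv_diff pderiv_minus pderiv_smult pderiv_pCons algebra_simps)
  then show ?thesis
    unfolding gegenbauer_ode_def by (subst poly_eq_poly_eq_iff[symmetric]) (simp add: fun_eq_iff)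
qed

text \<open>At 1 the leading coefficient vanishes and the equation reads \<open>a\<close> P'(1) =
  \<open>lam\<close> P(1) = 0. So P' is a solution of smaller degree that vanishes at 1, hence zero
  by induction, and P is a constant with value 0 at 1.\<close>

lemma gegenbauer_ode_eq_0:
  assumes "gegenbauer_ode a lam P" "a > 0" "poly P 1 = 0"
  shows "P = 0"
  using assms
proof (induction "degree P" arbitrary: P a lam rule: less_induct)
  case less
  have d0: "pderiv P = 0"
  proof (cases "degree P = 0")
    case True
    then show ?thesis by (simp add: pderiv_eq_0_iff)
  next
    case False
    have "poly (pderiv P) 1 = 0"
      using gegenbauer_ode_poly[OF less.prems(1), of 1] less.prems by simp
    with False less.hyps[OF _ gegenbauer_ode_pderiv[OF less.prems(1)]] less.prems(2)
    show ?thesis by (simp add: degree_pderiv)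
  qed
  then obtain c where "P = [:c:]"
    by (metis degree_eq_zeroE pderiv_eq_0_iff)
  with less.prems show ?case by simp
qed

lemma gegenbauer_ode_diff:
  "gegenbauer_ode a lam P \<Longrightarrow> gegenbauer_ode a lam Q \<Longrightarrow> gegenbauer_ode a lam (P - Q)"
proof -
  have "[:1, 0, -1:] * pderiv (pderiv (P - Q)) - smult a ([:0, 1:] * pderiv (P - Q)) + smult lam (P - Q)
    = ([:1, 0, -1:] * pderiv (pderiv P) - smult a ([:0, 1:] * pderiv P) + smult lam P)
      - ([:1, 0, -1:] * pderiv (pderiv Q) - smult a ([:0, 1:] * pderiv Q) + smult lam Q)"
    by (simp only: pderiv_diff smult_diff_right right_diff_distrib algebra_simps)
  then show "gegenbauer_ode a lam P \<Longrightarrow> gegenbauer_ode a lam Q \<Longrightarrow> gegenbauer_ode a lam (P - Q)"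
    unfolding gegenbauer_ode_def by simp
qed

text \<open>Sonin's argument: \<open>Q\<^sup>2 + (1 - x\<^sup>2) Q'\<^sup>2 / lam\<close> has derivative
  \<open>2 (a - 1) x Q'\<^sup>2 / lam\<close>.\<close>

lemma gegenbauer_ode_bound:
  assumes ode: "gegenbauer_ode a lam Q" and "a \<ge> 1" "lam > 0" "0 \<le> x" "x \<le> 1"
  shows "\<bar>poly Q x\<bar> \<le> \<bar>poly Q 1\<bar>"
proof -
  let ?F = "\<lambda>y. (poly Q y)\<^sup>2 + (1 - y\<^sup>2) * (poly (pderiv Q) y)\<^sup>2 / lam"
  have "?F x \<le> ?F 1"
  proof (rule DERIV_nonneg_imp_nondecreasing[OF \<open>x \<le> 1\<close>])
    fix y assume y: "x \<le> y" "y \<le> 1"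
    \<comment> \<open>The equation replaces (1 - y^2) Q'' by \<open>a\<close> y Q' -
      \<open>lam\<close> Q; the terms in Q Q' then cancel.\<close>
    have eq: "2 * poly Q y * poly (pderiv Q) y + ((1 - y\<^sup>2) * (2 * poly (pderiv Q) y * poly (pderiv (pderiv Q)) y)
          - 2 * y * (poly (pderiv Q) y)\<^sup>2) / lam
        = 2 * (a - 1) * y * (poly (pderiv Q) y)\<^sup>2 / lam"
      using gegenbauer_ode_poly[OF ode, of y] \<open>lam > 0\<close>
      by (simp add: field_simps power2_eq_square) algebra
    have "(?F has_real_derivative 2 * (a - 1) * y * (poly (pderiv Q) y)\<^sup>2 / lam) (at y)"
      unfolding eq[symmetric]
      by (rule derivative_eq_intros refl poly_DERIV | use \<open>lam > 0\<close> in force)+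
    moreover have "0 \<le> 2 * (a - 1) * y * (poly (pderiv Q) y)\<^sup>2 / lam"
      using assms y by auto
    ultimately show "\<exists>z. (?F has_real_derivative z) (at y) \<and> 0 \<le> z" by blast
  qed
  moreover have "0 \<le> (1 - x\<^sup>2) * (poly (pderiv Q) x)\<^sup>2 / lam"
    using assms by (simp add: power_le_one)
  ultimately have "(poly Q x)\<^sup>2 \<le> (poly Q 1)\<^sup>2" by simp
  then show ?thesis by (simp add: abs_le_square_iff)
qed

section \<open>The three-term recurrence\<close>

text \<open>For d = 2 these are the Chebyshev polynomials of the first kind, for d = 3 the classical
  Legendre polynomials.\<close>

fun legendre_rec :: "real \<Rightarrow> nat \<Rightarrow> real poly" where
  "legendre_rec d 0 = 1"
| "legendre_rec d (Suc 0) = [:0, 1:]"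
| "legendre_rec d (Suc (Suc k)) =
     smult ((2 * real k + d) / (real k + d - 1)) ([:0, 1:] * legendre_rec d (Suc k))
     - smult ((real k + 1) / (real k + d - 1)) (legendre_rec d k)"

text \<open>Clears the common denominator of the recurrence.\<close>

lemma mult_divide_diff:
  "a \<noteq> 0 \<Longrightarrow> a * (b / a * c - e / a * f) = b * c - e * f" for a :: real
  by (simp add: right_diff_distrib)

lemma legendre_rec_one: "d \<ge> 2 \<Longrightarrow> poly (legendre_rec d k) 1 = 1"
proof (induction d k rule: legendre_rec.induct)
  case (3 d k)
  have "real k + d - 1 \<noteq> 0" using 3 by simp
  then show ?case using 3 by (simp add: diff_divide_distrib[symmetric])
qed auto

lemma legendre_rec_minus: "poly (legendre_rec d k) (- x) = (-1) ^ k * poly (legendre_rec d k) x"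
  by (induction d k rule: legendre_rec.induct) (auto simp: algebra_simps)

lemma legendre_rec_step:
  assumes "d \<ge> 2"
  shows "(real k + d - 1) * poly (legendre_rec d (Suc (Suc k))) x
    = (2 * real k + d) * x * poly (legendre_rec d (Suc k)) x - (real k + 1) * poly (legendre_rec d k) x"
  using assms mult_divide_diff[of "real k + d - 1"] by (simp add: mult.assoc)

lemma legendre_rec_pderiv_step:
  assumes "d \<ge> 2"
  shows "(real k + d - 1) * poly (pderiv (legendre_rec d (Suc (Suc k)))) x
    = (2 * real k + d) * (poly (legendre_rec d (Suc k)) x + x * poly (pderiv (legendre_rec d (Suc k))) x)
      - (real k + 1) * poly (pderiv (legendre_rec d k)) x"
  using assms mult_divide_diff[of "real k + d - 1"]
  by (simp add: pderiv_diff pderiv_smult pderiv_mult pderiv_pCons add.commute del: mult_pCons_left)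

lemma legendre_rec_pderiv:
  assumes d: "d \<ge> 2"
  shows "(1 - x\<^sup>2) * poly (pderiv (legendre_rec d (Suc k))) x
      = (real k + 1) * (poly (legendre_rec d k) x - x * poly (legendre_rec d (Suc k)) x)"
proof -
  define P where "P j = poly (legendre_rec d j) x" for j
  define P' where "P' j = poly (pderiv (legendre_rec d j)) x" for j
  have rec: "(real k + d - 1) * P (Suc (Suc k)) = (2 * real k + d) * x * P (Suc k) - (real k + 1) * P k"
    and rec': "(real k + d - 1) * P' (Suc (Suc k))
      = (2 * real k + d) * (P (Suc k) + x * P' (Suc k)) - (real k + 1) * P' k" for k
    unfolding P_def P'_def by (rule legendre_rec_step[OF d] legendre_rec_pderiv_step[OF d])+
  \<comment> \<open>The first identity is not inductive alone. The companion expresses (1 - x^2)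
    P_k' through the same two polynomials; the recurrence turns the first identity into the
    companion at the next index (\<open>b\<close>), and the differentiated recurrence then gives the
    next first identity.\<close>
  have "(1 - x\<^sup>2) * P' (Suc k) = (real k + 1) * (P k - x * P (Suc k)) \<and>
        (1 - x\<^sup>2) * P' k = (real k + d - 2) * (x * P k - P (Suc k))"
  proof (induction k)
    case 0
    then show ?case by (simp add: P_def P'_def pderiv_pCons power2_eq_square)
  next
    case (Suc k)
    have b: "(1 - x\<^sup>2) * P' (Suc k) = (real k + d - 1) * (x * P (Suc k) - P (Suc (Suc k)))"
      using Suc rec[of k] by algebra
    have "(real k + d - 1) * ((1 - x\<^sup>2) * P' (Suc (Suc k)))
      = (real k + d - 1) * ((real k + 2) * (P (Suc k) - x * P (Suc (Suc k))))"
      using Suc b rec[of k] rec'[of k] by algebra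
    moreover have "real k + d - 1 \<noteq> 0" using d by simp
    ultimately have "(1 - x\<^sup>2) * P' (Suc (Suc k)) = (real k + 2) * (P (Suc k) - x * P (Suc (Suc k)))"
      using mult_left_cancel by blast
    with b show ?case by (simp add: algebra_simps)
  qed
  then show ?thesis by (simp add: P_def P'_def)
qed

text \<open>Eliminating P_(k+2) by the recurrence gives (k + d - 1) (P_k - P_(k+2)) = (2k + d) (P_k
  - x P_(k+1)), and \<open>legendre_rec_pderiv\<close> rewrites the last bracket.\<close>

lemma legendre_rec_diff:
  assumes d: "d \<ge> 2"
  shows "(real k + 1) * (real k + d - 1)
        * (poly (legendre_rec d k) x - poly (legendre_rec d (Suc (Suc k))) x)
      = (2 * real k + d) * (1 - x\<^sup>2) * poly (pderiv (legendre_rec d (Suc k))) x"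
  using legendre_rec_pderiv[OF d, of x k] legendre_rec_step[OF d, of k x] by algebra

section \<open>Zonal harmonic polynomials on the whole space\<close>

text \<open>The solid harmonic |x|^k P_k(x_i/|x|). The factor \<open>x \<bullet> x\<close> makes the
  recurrence homogeneous, so the function is visibly a polynomial, without square roots.\<close>

fun zonal :: "'n::finite \<Rightarrow> nat \<Rightarrow> real ^ 'n \<Rightarrow> real" where
  "zonal i 0 x = 1"
| "zonal i (Suc 0) x = x $ i"
| "zonal i (Suc (Suc k)) x =
     (2 * real k + real CARD('n)) / (real k + real CARD('n) - 1) * (x $ i * zonal i (Suc k) x)
     - (real k + 1) / (real k + real CARD('n) - 1) * ((x \<bullet> x) * zonal i k x)"

text \<open>\<open>zonal_d\<close> and \<open>zonal_dd\<close> are the first and second derivatives along \<^term>\<open>axis j 1\<close>,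
  given by the differentiated recurrence.\<close>

fun zonal_d :: "'n::finite \<Rightarrow> 'n \<Rightarrow> nat \<Rightarrow> real ^ 'n \<Rightarrow> real" where
  "zonal_d i j 0 x = 0"
| "zonal_d i j (Suc 0) x = of_bool (j = i)"
| "zonal_d i j (Suc (Suc k)) x =
     (2 * real k + real CARD('n)) / (real k + real CARD('n) - 1)
       * (of_bool (j = i) * zonal i (Suc k) x + x $ i * zonal_d i j (Suc k) x)
     - (real k + 1) / (real k + real CARD('n) - 1)
       * (2 * x $ j * zonal i k x + (x \<bullet> x) * zonal_d i j k x)"

fun zonal_dd :: "'n::finite \<Rightarrow> 'n \<Rightarrow> nat \<Rightarrow> real ^ 'n \<Rightarrow> real" where
  "zonal_dd i j 0 x = 0"
| "zonal_dd i j (Suc 0) x = 0"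
| "zonal_dd i j (Suc (Suc k)) x =
     (2 * real k + real CARD('n)) / (real k + real CARD('n) - 1)
       * (2 * of_bool (j = i) * zonal_d i j (Suc k) x + x $ i * zonal_dd i j (Suc k) x)
     - (real k + 1) / (real k + real CARD('n) - 1)
       * (2 * zonal i k x + 4 * x $ j * zonal_d i j k x + (x \<bullet> x) * zonal_dd i j k x)"

lemma line_component_deriv:
  "((\<lambda>t. (x + t *\<^sub>R axis j 1) $ i) has_real_derivative of_bool (j = i)) (at t)"
  for x :: "real ^ 'n::finite"
proof -
  have eq: "(x + t *\<^sub>R axis j 1) $ i = x $ i + t * of_bool (j = i)" for t
    by (simp add: axis_def)
  show ?thesis unfolding eq by (auto intro!: derivative_eq_intros)
qed

lemma line_inner_deriv:
  "((\<lambda>t. (x + t *\<^sub>R axis j 1) \<bullet> (x + t *\<^sub>R axis j 1))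
     has_real_derivative 2 * (x + t *\<^sub>R axis j 1) $ j) (at t)"
  for x :: "real ^ 'n::finite"
proof -
  have eq: "(x + t *\<^sub>R axis j 1) \<bullet> (x + t *\<^sub>R axis j 1) = x \<bullet> x + 2 * t * x $ j + t\<^sup>2" for t
    by (simp add: inner_add_left inner_add_right inner_axis inner_axis' power2_eq_square algebra_simps)
  have eq': "2 * (x + t *\<^sub>R axis j 1) $ j = 2 * x $ j + 2 * t" by simp
  show ?thesis unfolding eq eq' by (auto intro!: derivative_eq_intros)
qed

text \<open>Stated at every \<open>t\<close> on the line, since the second derivative at 0 requires
  the first one nearby.\<close>

lemma zonal_deriv:
  "((\<lambda>t. zonal i k (x + t *\<^sub>R axis j 1)) has_real_derivative zonal_d i j k (x + t *\<^sub>R axis j 1)) (at t)"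
proof (induction k arbitrary: t rule: induct_nat_012)
  case 1
  show ?case by (simp only: zonal.simps zonal_d.simps line_component_deriv)
next
  case (ge2 k)
  show ?case
    unfolding zonal.simps zonal_d.simps
    by (rule derivative_eq_intros line_component_deriv line_inner_deriv ge2 refl)+
       (simp add: algebra_simps)
qed simp

lemma zonal_d_deriv:
  "((\<lambda>t. zonal_d i j k (x + t *\<^sub>R axis j 1)) has_real_derivative zonal_dd i j k (x + t *\<^sub>R axis j 1)) (at t)"
proof (induction k arbitrary: t rule: induct_nat_012)
  case (ge2 k)
  show ?case
    unfolding zonal_d.simps zonal_dd.simps
    by (rule derivative_eq_intros line_component_deriv line_inner_deriv zonal_deriv ge2 refl)+
       (simp add: algebra_simps)
qed simp_all

lemma laplacian_zonal: "laplacian (zonal i k) x = (\<Sum>j\<in>UNIV. zonal_dd i j k x)"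
proof -
  have "deriv (\<lambda>t. zonal i k (x + t *\<^sub>R axis j 1)) = (\<lambda>t. zonal_d i j k (x + t *\<^sub>R axis j 1))" for j
    by (rule ext) (rule DERIV_imp_deriv[OF zonal_deriv])
  moreover have "deriv (\<lambda>t. zonal_d i j k (x + t *\<^sub>R axis j 1)) 0 = zonal_dd i j k x" for j
    using DERIV_imp_deriv[OF zonal_d_deriv[of i j k x 0]] by simp
  ultimately show ?thesis by (simp add: laplacian_def numeral_2_eq_2)
qed

text \<open>This is the relation that makes the recurrence preserve harmonicity.\<close>

lemma zonal_d_axis:
  assumes "CARD('n::finite) \<ge> 2"
  shows "zonal_d (i::'n) i (Suc k) x = (real k + 1) * zonal i k x"
proof (induction k rule: induct_nat_012)
  case 1
  have "real CARD('n) - 1 \<noteq> 0" using assms by simp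
  then show ?case by (simp add: divide_simps) (simp add: algebra_simps)
next
  case (ge2 k)
  have "real CARD('n) \<ge> 2" using assms by simp
  then have nz: "real k + real CARD('n) - 1 \<noteq> 0" "real k + real CARD('n) \<noteq> 0" by linarith+
  define a where "a = real k + real CARD('n) - 1"
  define z where "z = zonal i (Suc (Suc k)) x"
  define y where "y = zonal i (Suc k) x"
  have "a \<noteq> 0" unfolding a_def by (rule nz)
  have z: "a * z = (2 * real k + real CARD('n)) * x $ i * y - (real k + 1) * (x \<bullet> x) * zonal i k x"
    unfolding z_def y_def zonal.simps a_def[symmetric] mult_divide_diff[OF \<open>a \<noteq> 0\<close>] by (simp only: mult.assoc)
  have "(real k + real CARD('n)) * zonal_d i i (Suc (Suc (Suc k))) x
      = (2 * (real k + 1) + real CARD('n)) * (z + x $ i * ((real k + 2) * y))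
        - (real k + 2) * (2 * x $ i * y + (x \<bullet> x) * ((real k + 1) * zonal i k x))"
  proof -
    have "real (Suc k) + real CARD('n) - 1 = real k + real CARD('n)" by simp
    then show ?thesis
      unfolding zonal_d.simps(3)[of i i "Suc k"] ge2 z_def y_def
      by (simp only: mult_divide_diff[OF nz(2)])
         (simp add: add_ac del: zonal.simps)
  qed
  \<comment> \<open>Inserting \<open>z\<close> for the term in \<open>x \<bullet> x\<close> cancels
    all multiples of \<open>x $ i * y\<close>; the coefficient of z that remains factors as (k + d)
    (k + 3).\<close>
  also have "\<dots> = (real k + real CARD('n)) * ((real k + 3) * z)"
    using z unfolding a_def by algebra
  finally have "zonal_d i i (Suc (Suc (Suc k))) x = (real k + 3) * z"
    using mult_left_cancel[OF nz(2)] by blast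
  then show ?case unfolding z_def by (simp add: add_ac del: zonal.simps zonal_d.simps)
qed simp

lemma inner_eq_sum_power2: "(\<Sum>j\<in>UNIV. (x $ j)\<^sup>2) = x \<bullet> x" for x :: "real ^ 'n::finite"
  by (simp add: inner_vec_def power2_eq_square)

lemma sum_of_bool_mult: "(\<Sum>j\<in>UNIV. of_bool (j = i) * f j) = f i" for i :: "'n::finite" and f :: "'n \<Rightarrow> real"
  by (simp add: of_bool_def if_distrib[of "\<lambda>c. c * _"] cong: if_cong)

text \<open>Euler's identity for homogeneous functions. It evaluates the cross term in the Laplacian
  of |x|^2 times a zonal polynomial.\<close>

lemma zonal_euler: "(\<Sum>j\<in>UNIV. x $ j * zonal_d i j k x) = real k * zonal i k x"
proof (induction k rule: induct_nat_012)
  case 1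
  show ?case using sum_of_bool_mult[of i "\<lambda>j. x $ j"] by (simp add: mult.commute)
next
  case (ge2 k)
  define A where "A = (2 * real k + real CARD('a)) / (real k + real CARD('a) - 1)"
  define B where "B = (real k + 1) / (real k + real CARD('a) - 1)"
  have "(\<Sum>j\<in>UNIV. x $ j * zonal_d i j (Suc (Suc k)) x)
    = (\<Sum>j\<in>UNIV. A * zonal i (Suc k) x * (of_bool (j = i) * x $ j)
        + A * x $ i * (x $ j * zonal_d i j (Suc k) x)
        - (B * 2 * zonal i k x * (x $ j)\<^sup>2 + B * (x \<bullet> x) * (x $ j * zonal_d i j k x)))"
    unfolding zonal_d.simps A_def[symmetric] B_def[symmetric]
    by (intro sum.cong) (simp_all add: algebra_simps power2_eq_square)
  also have "\<dots> = A * zonal i (Suc k) x * x $ i + A * x $ i * (real (Suc k) * zonal i (Suc k) x)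
      - (B * 2 * zonal i k x * (x \<bullet> x) + B * (x \<bullet> x) * (real k * zonal i k x))"
    by (simp only: sum.distrib sum_subtractf sum_distrib_left[symmetric] ge2
        inner_eq_sum_power2 sum_of_bool_mult)
  also have "\<dots> = real (Suc (Suc k)) * zonal i (Suc (Suc k)) x"
    unfolding zonal.simps A_def[symmetric] B_def[symmetric] by (simp add: algebra_simps)
  finally show ?case .
qed simp

text \<open>Write Z_k for the zonal polynomial. By induction the Laplacian of x_i Z_(k+1) is 2 (k +
  1) Z_k, by \<open>zonal_d_axis\<close>, and that of |x|^2 Z_k is (2d + 4k) Z_k, by
  \<open>zonal_euler\<close>. The coefficients of the recurrence make the two cancel.\<close>

lemma zonal_harmonic:
  assumes "CARD('n::finite) \<ge> 2"
  shows "(\<Sum>j\<in>UNIV. zonal_dd (i::'n) j k x) = 0"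
proof (induction k rule: induct_nat_012)
  case (ge2 k)
  define A where "A = (2 * real k + real CARD('n)) / (real k + real CARD('n) - 1)"
  define B where "B = (real k + 1) / (real k + real CARD('n) - 1)"
  have "(\<Sum>j\<in>UNIV. zonal_dd i j (Suc (Suc k)) x)
    = (\<Sum>j\<in>UNIV. A * 2 * (of_bool (j = i) * zonal_d i j (Suc k) x) + A * x $ i * zonal_dd i j (Suc k) x
        - (B * 2 * zonal i k x + B * 4 * (x $ j * zonal_d i j k x) + B * (x \<bullet> x) * zonal_dd i j k x))"
    unfolding zonal_dd.simps A_def[symmetric] B_def[symmetric]
    by (intro sum.cong) (simp_all add: algebra_simps)
  also have "\<dots> = A * 2 * zonal_d i i (Suc k) x + A * x $ i * 0
      - (real CARD('n) * (B * 2 * zonal i k x) + B * 4 * (real k * zonal i k x) + B * (x \<bullet> x) * 0)"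
    by (simp only: sum.distrib sum_subtractf sum_constant)
       (simp only: sum_distrib_left[symmetric] ge2 zonal_euler sum_of_bool_mult)
  also have "\<dots> = 0"
  proof -
    have "A * (real k + 1) = B * (2 * real k + real CARD('n))"
      by (simp add: A_def B_def)
    then show ?thesis unfolding zonal_d_axis[OF assms] by algebra
  qed
  finally show ?case .
qed simp_all

lemma real_polynomial_function_zonal: "real_polynomial_function (zonal i k)"
proof (induction k rule: induct_nat_012)
  case 0
  show ?case unfolding zonal.simps[abs_def] by (rule real_polynomial_function.intros)
next
  case 1
  show ?case unfolding zonal.simps[abs_def]
    by (rule real_polynomial_function.intros(1)) (rule bounded_linear_vec_nth)
next
  case (ge2 k)
  have comp: "real_polynomial_function (\<lambda>x::real^'a. x $ j)" for j
    by (rule real_polynomial_function.intros(1)) (rule bounded_linear_vec_nth)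
  have "real_polynomial_function (\<lambda>x::real^'a. x \<bullet> x)"
    unfolding inner_vec_def inner_real_def
    by (rule real_polynomial_function_sum) (auto intro: comp)
  then show ?case
    unfolding zonal.simps[abs_def]
    by (intro real_polynomial_function_diff real_polynomial_function.intros(2,4) comp) (use ge2 in auto)
qed

lemma zonal_scale: "zonal i k (c *\<^sub>R x) = c ^ k * zonal i k x"
  by (induction k rule: induct_nat_012) (simp_all add: algebra_simps power2_eq_square)

lemma zonal_sphere:
  "norm \<sigma> = 1 \<Longrightarrow> zonal i k \<sigma> = poly (legendre_rec (real CARD('n)) k) (\<sigma> $ i)"
  for \<sigma> :: "real ^ 'n::finite"
  by (induction k rule: induct_nat_012) (simp_all add: norm_eq_1)

lemma homogeneous_harmonic_zonal:
  "CARD('n::finite) \<ge> 2 \<Longrightarrow> homogeneous_harmonic_polynomial k (zonal (i::'n) k)"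
  by (simp add: homogeneous_harmonic_polynomial_def real_polynomial_function_zonal zonal_scale
      laplacian_zonal zonal_harmonic)

section \<open>From harmonicity to the Gegenbauer equation\<close>

text \<open>Here g is |x|^k P(x_i/|x|) along the line through a unit vector \<sigma> in direction j,
  with b = \<sigma>_j, t = \<sigma>_i and c the Kronecker delta of i and j. Below, \<open>n\<close>
  is the norm and \<open>v\<close> is x_i/|x|; the formula is the chain rule with their first two
  derivatives at 0.\<close>

lemma deriv2_radial_extension:
  fixes g :: "real \<Rightarrow> real"
  assumes g: "\<forall>\<^sub>F s in nhds 0. g s = sqrt (1 + 2 * b * s + s\<^sup>2) ^ k
                * poly P ((t + c * s) / sqrt (1 + 2 * b * s + s\<^sup>2))"
  shows "(deriv ^^ 2) g 0 = (real k * (real k - 1) * b\<^sup>2 + real k * (1 - b\<^sup>2)) * poly P t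
    + (2 * real k * b * (c - t * b) + (t * (3 * b\<^sup>2 - 1) - 2 * c * b)) * poly (pderiv P) t
    + (c - t * b)\<^sup>2 * poly (pderiv (pderiv P)) t"
proof -
  define n where "n s = sqrt (1 + 2 * b * s + s\<^sup>2)" for s
  define v where "v s = (t + c * s) / n s" for s
  define v' where "v' s = (c * n s - (t + c * s) * ((b + s) / n s)) / (n s * n s)" for s
  let ?G = "\<lambda>s. n s ^ k * poly P (v s)"
  let ?G' = "\<lambda>s. real k * n s ^ (k - 1) * ((b + s) / n s) * poly P (v s)
               + n s ^ k * (poly (pderiv P) (v s) * v' s)"
  have pos: "\<forall>\<^sub>F s in nhds 0. 1 + 2 * b * s + s\<^sup>2 > 0"
  proof -
    have "((\<lambda>s. 1 + 2 * b * s + s\<^sup>2) \<longlongrightarrow> 1 + 2 * b * 0 + 0\<^sup>2) (nhds 0)"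
      by (intro tendsto_intros filterlim_ident)
    then show ?thesis by (rule order_tendstoD(1)) simp
  qed
  have n_deriv: "(n has_real_derivative (b + s) / n s) (at s)" if "1 + 2 * b * s + s\<^sup>2 > 0" for s
    unfolding n_def[abs_def] using that by (auto intro!: derivative_eq_intros simp: field_simps)
  have v_deriv: "(v has_real_derivative v' s) (at s)" if s: "1 + 2 * b * s + s\<^sup>2 > 0" for s
    unfolding v_def[abs_def] v'_def
    by (rule derivative_eq_intros n_deriv s refl | use s in \<open>simp add: n_def\<close>)+
  have G_deriv: "(?G has_real_derivative ?G' s) (at s)" if s: "1 + 2 * b * s + s\<^sup>2 > 0" for s
    by (rule derivative_eq_intros n_deriv v_deriv DERIV_chain2[OF poly_DERIV] s refl)+
       (simp add: algebra_simps)
  \<comment> \<open>Equal derivatives at s require agreement near s, not only at s.\<close>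
  have "\<forall>\<^sub>F s in nhds 0. \<forall>\<^sub>F r in nhds s. g r = ?G r"
    using g unfolding eventually_eventually n_def v_def .
  then have "\<forall>\<^sub>F s in nhds 0. deriv g s = ?G' s"
    using pos
  proof eventually_elim
    case (elim s)
    then show ?case
      using deriv_cong_ev[of g ?G s s] DERIV_imp_deriv[OF G_deriv[of s]] by simp
  qed
  then have "deriv (deriv g) 0 = deriv ?G' 0"
    by (rule deriv_cong_ev) simp
  moreover have n0: "n 0 = 1" and v0: "v 0 = t" and v'0: "v' 0 = c - t * b"
    by (simp_all add: n_def v_def v'_def)
  have n0': "(n has_real_derivative b) (at 0)"
    using n_deriv[of 0] n0 by simp
  have v0': "(v has_real_derivative c - t * b) (at 0)"
    using v_deriv[of 0] v'0 by simp
  have n0'': "((\<lambda>s. (b + s) / n s) has_real_derivative 1 - b\<^sup>2) (at 0)"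
    by (rule derivative_eq_intros n0' refl | simp add: n0 power2_eq_square)+
  have v0'': "(v' has_real_derivative t * (3 * b\<^sup>2 - 1) - 2 * c * b) (at 0)"
    unfolding v'_def[abs_def]
    by (rule derivative_eq_intros n0' n0'' refl | simp add: n0 power2_eq_square algebra_simps)+
  have "(?G' has_real_derivative
     (real k * (real k - 1) * b\<^sup>2 + real k * (1 - b\<^sup>2)) * poly P t
    + (2 * real k * b * (c - t * b) + (t * (3 * b\<^sup>2 - 1) - 2 * c * b)) * poly (pderiv P) t
    + (c - t * b)\<^sup>2 * poly (pderiv (pderiv P)) t) (at 0)"
    \<comment> \<open>The exponent \<open>k - 1\<close> truncates at k = 0, where the factor
      \<open>real k\<close> vanishes; hence the case split.\<close>
    by (rule derivative_eq_intros n0' n0'' v0' v0'' DERIV_chain2[OF poly_DERIV] refl)+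
       (cases k; simp add: n0 v0 v'0 power2_eq_square; simp add: algebra_simps)
  ultimately show ?thesis by (simp add: numeral_2_eq_2 DERIV_imp_deriv)
qed

text \<open>Homogeneity gives p(x) = |x|^k P(x_i/|x|) away from 0. Its Laplacian at a unit vector is
  the left side of the equation at t = \<sigma>_i. All t in [-1,1] occur, so the polynomial has
  infinitely many roots.\<close>

lemma legendre_ode:
  fixes i :: "'n::finite"
  assumes card: "CARD('n) \<ge> 2"
    and sph: "spherical_harmonic k (\<lambda>\<sigma>. poly P (axis i 1 \<bullet> \<sigma>))"
  shows "gegenbauer_ode (real CARD('n) - 1) (real k * (real k + real CARD('n) - 2)) P"
proof -
  obtain p where hom: "\<And>c x. p (c *\<^sub>R x) = c ^ k * p x" and lap: "\<And>x. laplacian p x = 0"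
    and p: "\<And>\<sigma>::real^'n. norm \<sigma> = 1 \<Longrightarrow> p \<sigma> = poly P (\<sigma> $ i)"
    using sph unfolding spherical_harmonic_def homogeneous_harmonic_polynomial_def
    by (auto simp: inner_axis') (metis (no_types, lifting) dist_0_norm mem_sphere)
  \<comment> \<open>A second coordinate, used to complete \<open>t\<close> to a unit vector.\<close>
  obtain m :: 'n where m: "m \<noteq> i"
    using card by (metis (full_types) UNIV_I card_le_Suc0_iff_eq finite not_less_eq_eq numeral_2_eq_2)
  let ?d = "real CARD('n)"
  let ?O = "[:1, 0, -1:] * pderiv (pderiv P) - smult (?d - 1) ([:0, 1:] * pderiv P)
    + smult (real k * (real k + ?d - 2)) P"
  have root: "poly ?O t = 0" if t: "t \<in> {-1..1}" for t
  proof -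
    define \<sigma> :: "real ^ 'n" where "\<sigma> = t *\<^sub>R axis i 1 + sqrt (1 - t\<^sup>2) *\<^sub>R axis m 1"
    have t2: "t\<^sup>2 \<le> 1" using t by (simp add: abs_square_le_1 abs_le_iff)
    have \<sigma>i: "\<sigma> $ i = t" using m by (simp add: \<sigma>_def axis_def)
    have ss: "\<sigma> \<bullet> \<sigma> = 1"
      using m t2 by (simp add: \<sigma>_def inner_add_left inner_add_right inner_axis_axis
          power2_eq_square[symmetric])
    have dd: "(deriv ^^ 2) (\<lambda>s. p (\<sigma> + s *\<^sub>R axis j 1)) 0 =
        (real k * (real k - 1) * (\<sigma> $ j)\<^sup>2 + real k * (1 - (\<sigma> $ j)\<^sup>2)) * poly P t
      + (2 * real k * \<sigma> $ j * (of_bool (j = i) - t * \<sigma> $ j)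
          + (t * (3 * (\<sigma> $ j)\<^sup>2 - 1) - 2 * of_bool (j = i) * \<sigma> $ j)) * poly (pderiv P) t
      + (of_bool (j = i) - t * \<sigma> $ j)\<^sup>2 * poly (pderiv (pderiv P)) t" (is "_ = ?T j") for j
    proof (rule deriv2_radial_extension)
      have nrm: "norm (\<sigma> + s *\<^sub>R axis j 1) = sqrt (1 + 2 * \<sigma> $ j * s + s\<^sup>2)" for s
        unfolding norm_eq_sqrt_inner
        by (simp add: inner_add_left inner_add_right inner_axis inner_axis' ss power2_eq_square algebra_simps)
      have "((\<lambda>s. norm (\<sigma> + s *\<^sub>R axis j 1)) \<longlongrightarrow> norm (\<sigma> + 0 *\<^sub>R axis j 1)) (nhds 0)"
        by (intro tendsto_intros filterlim_ident)
      then have "\<forall>\<^sub>F s in nhds 0. norm (\<sigma> + s *\<^sub>R axis j 1) > 0"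
        by (rule order_tendstoD(1)) (simp add: norm_eq_sqrt_inner ss)
      then show "\<forall>\<^sub>F s in nhds 0. p (\<sigma> + s *\<^sub>R axis j 1) = sqrt (1 + 2 * \<sigma> $ j * s + s\<^sup>2) ^ k
          * poly P ((t + of_bool (j = i) * s) / sqrt (1 + 2 * \<sigma> $ j * s + s\<^sup>2))"
      proof eventually_elim
        case (elim s)
        let ?y = "\<sigma> + s *\<^sub>R axis j 1"
        have "p ?y = p (norm ?y *\<^sub>R (?y /\<^sub>R norm ?y))" using elim by simp
        also have "\<dots> = norm ?y ^ k * poly P ((?y /\<^sub>R norm ?y) $ i)"
          using elim by (subst hom, subst p) auto
        also have "(?y /\<^sub>R norm ?y) $ i = (t + of_bool (j = i) * s) / norm ?y"
          by (simp add: \<sigma>i axis_def divide_inverse mult.commute)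
        finally show ?case by (simp only: nrm)
      qed
    qed
    have "0 = (\<Sum>j\<in>UNIV. ?T j)"
      using lap[of \<sigma>] unfolding laplacian_def dd by simp
    \<comment> \<open>Sorted by the dependence on j: the factors 1, \<sigma>_j^2, delta_ij
      \<sigma>_j and delta_ij sum to d, 1, t and 1.\<close>
    also have "\<dots> = (\<Sum>j\<in>UNIV. (real k * poly P t - t * poly (pderiv P) t)
       + ((real k * (real k - 1) - real k) * poly P t + (3 * t - 2 * real k * t) * poly (pderiv P) t
          + t\<^sup>2 * poly (pderiv (pderiv P)) t) * (\<sigma> $ j)\<^sup>2
       + ((2 * real k - 2) * poly (pderiv P) t - 2 * t * poly (pderiv (pderiv P)) t)
           * (of_bool (j = i) * \<sigma> $ j)
       + poly (pderiv (pderiv P)) t * (of_bool (j = i) * 1))"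
      by (intro sum.cong refl) (auto simp: algebra_simps power2_eq_square)
    also have "\<dots> = ?d * (real k * poly P t - t * poly (pderiv P) t)
       + ((real k * (real k - 1) - real k) * poly P t + (3 * t - 2 * real k * t) * poly (pderiv P) t
          + t\<^sup>2 * poly (pderiv (pderiv P)) t) * 1
       + ((2 * real k - 2) * poly (pderiv P) t - 2 * t * poly (pderiv (pderiv P)) t) * t
       + poly (pderiv (pderiv P)) t * 1"
      by (simp only: sum.distrib sum_distrib_left[symmetric] inner_eq_sum_power2 ss \<sigma>i
          sum_of_bool_mult sum_constant)
    also have "\<dots> = poly ?O t"
      by (simp add: algebra_simps power2_eq_square)
    finally show ?thesis by simp
  qed
  have "infinite {-1..1::real}" by (rule infinite_Icc) simp
  then have "infinite {t. poly ?O t = 0}"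
    by (rule contrapos_nn) (rule finite_subset, use root in auto)
  then have "?O = 0" using poly_roots_finite by blast
  then show ?thesis unfolding gegenbauer_ode_def .
qed

section \<open>Identification of the Legendre polynomials\<close>

lemma spherical_harmonic_legendre_rec:
  fixes i :: "'n::finite"
  assumes "CARD('n) \<ge> 2"
  shows "spherical_harmonic k (\<lambda>\<sigma>. poly (legendre_rec (real CARD('n)) k) (axis i 1 \<bullet> \<sigma>))"
  unfolding spherical_harmonic_def
  using homogeneous_harmonic_zonal[OF assms, of k i]
  by (auto simp: inner_axis' zonal_sphere intro!: exI[of _ "zonal i k"])

text \<open>Existence comes from the zonal polynomials. For uniqueness, the difference of two
  candidates solves the Gegenbauer equation and vanishes at 1.\<close>

lemma legendre_poly_eq:
  fixes i :: "'n::finite"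
  assumes card: "CARD('n) \<ge> 2"
  shows "legendre_poly i k = legendre_rec (real CARD('n)) k"
  unfolding legendre_poly_def
proof (rule the_equality, intro conjI)
  let ?L = "legendre_rec (real CARD('n)) k"
  show L1: "poly ?L 1 = 1" using card by (simp add: legendre_rec_one)
  show "spherical_harmonic k (\<lambda>\<sigma>. poly ?L (axis i 1 \<bullet> \<sigma>))"
    by (rule spherical_harmonic_legendre_rec[OF card])
  \<comment> \<open>If T preserves inner products and fixes e, then e . T \<sigma> = T e . T
    \<sigma> = e . \<sigma>.\<close>
  show "axially_symmetric (axis i 1) (\<lambda>\<sigma>. poly ?L (axis i 1 \<bullet> \<sigma>))"
    unfolding axially_symmetric_def orthogonal_transformation_def by metis
  fix P
  assume P: "poly P 1 = 1 \<and> spherical_harmonic k (\<lambda>\<sigma>. poly P (axis i 1 \<bullet> \<sigma>)) \<and>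
    axially_symmetric (axis i 1) (\<lambda>\<sigma>. poly P (axis i 1 \<bullet> \<sigma>))"
  have "P - ?L = 0"
    using P L1 card
    by (intro gegenbauer_ode_eq_0[OF gegenbauer_ode_diff[OF legendre_ode legendre_ode]])
       (auto intro: spherical_harmonic_legendre_rec)
  then show "P = ?L" by simp
qed

section \<open>The inequality\<close>

text \<open>The right side is the left side at x = 1, read off from the equation there. The
  derivative solves the equation with \<open>a\<close> = d + 1 and \<open>lam\<close> = k (k + d),
  which is positive as k >= 1, so \<open>gegenbauer_ode_bound\<close> applies.\<close>

lemma legendre_rec_pderiv_bound:
  assumes card: "CARD('n::finite) \<ge> 2" and "k \<ge> 1" "0 \<le> x" "x \<le> 1"
  shows "(real CARD('n) - 1) * poly (pderiv (legendre_rec (real CARD('n)) (Suc k))) x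
    \<le> (real k + 1) * (real k + real CARD('n) - 1)"
proof -
  let ?d = "real CARD('n)" and ?Q = "pderiv (legendre_rec (real CARD('n)) (Suc k))"
  have ode: "gegenbauer_ode (?d - 1) (real (Suc k) * (real (Suc k) + ?d - 2)) (legendre_rec ?d (Suc k))"
    by (rule legendre_ode[OF card spherical_harmonic_legendre_rec[OF card]])
  have Q1: "(?d - 1) * poly ?Q 1 = (real k + 1) * (real k + ?d - 1)"
    using gegenbauer_ode_poly[OF ode, of 1] card by (simp add: legendre_rec_one algebra_simps)
  moreover have "0 \<le> (real k + 1) * (real k + ?d - 1)" using card by simp
  ultimately have "0 \<le> poly ?Q 1"
    using card by (metis diff_gt_0_iff_gt mult_le_0_iff not_le numeral_le_real_of_nat_iff
        one_less_numeral_iff order_less_le_trans semiring_norm(76) zero_le_mult_iff)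
  moreover have "\<bar>poly ?Q x\<bar> \<le> \<bar>poly ?Q 1\<bar>"
  proof (rule gegenbauer_ode_bound[OF gegenbauer_ode_pderiv[OF ode]])
    have "real (Suc k) * (real (Suc k) + ?d - 2) - (?d - 1) = real k * (real k + ?d)"
      by (simp add: algebra_simps)
    then show "0 < real (Suc k) * (real (Suc k) + ?d - 2) - (?d - 1)"
      using assms by simp
  qed (use assms in auto)
  ultimately have "poly ?Q x \<le> poly ?Q 1" by simp
  then show ?thesis unfolding Q1[symmetric] using card by (intro mult_left_mono) auto
qed

text \<open>The factor \<open>?m\<close> from \<open>legendre_rec_diff\<close> is also the bound on
  (d - 1) P_(k+1)', so it cancels.\<close>

lemma legendre_rec_diff_bound:
  assumes card: "CARD('n::finite) \<ge> 2" and "k \<ge> 1" "0 \<le> x" "x \<le> 1"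
  shows "(real CARD('n) - 1)
      * (poly (legendre_rec (real CARD('n)) k) x - poly (legendre_rec (real CARD('n)) (Suc (Suc k))) x)
    \<le> (2 * real k + real CARD('n)) * (1 - x\<^sup>2)"
proof -
  let ?d = "real CARD('n)" and ?m = "(real k + 1) * (real k + real CARD('n) - 1)"
  let ?D = "poly (legendre_rec ?d k) x - poly (legendre_rec ?d (Suc (Suc k))) x"
  have "?m * ((?d - 1) * ?D) = (?d - 1) * (?m * ?D)" by (simp only: mult_ac)
  also have "\<dots> = (2 * real k + ?d) * (1 - x\<^sup>2)
      * ((?d - 1) * poly (pderiv (legendre_rec ?d (Suc k))) x)"
    using legendre_rec_diff[of ?d k x] card by (simp add: mult_ac)
  also have "\<dots> \<le> (2 * real k + ?d) * (1 - x\<^sup>2) * ?m"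
    using assms by (intro mult_left_mono legendre_rec_pderiv_bound) (auto simp: power_le_one)
  finally have "?m * ((?d - 1) * ?D) \<le> ?m * ((2 * real k + ?d) * (1 - x\<^sup>2))"
    by (simp only: mult_ac)
  moreover have "?m > 0" using card by simp
  ultimately show ?thesis using mult_le_cancel_left_pos by blast
qed

theorem proposition2:
  fixes i :: "'n::finite" and l :: nat and x :: real
  assumes "CARD('n) \<ge> 2" and "l \<ge> 1" and "x \<in> {-1..1}"
  shows "poly (legendre_poly i (2 * l)) x - poly (legendre_poly i (2 * (l + 1))) x
    \<le> (sphere_eigenvalue CARD('n) (2 * (l + 1)) - sphere_eigenvalue CARD('n) (2 * l))
        / sphere_eigenvalue CARD('n) 2 * (1 - poly (legendre_poly i 2) x)"
proof -
  let ?d = "real CARD('n)" and ?L = "\<lambda>k. poly (legendre_rec (real CARD('n)) k)"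
  have d: "?d \<ge> 2" using assms(1) by simp
  \<comment> \<open>Even orders give even functions, so the bound for nonnegative arguments may be
    used at |x|.\<close>
  have even: "?L (2 * k) \<bar>x\<bar> = ?L (2 * k) x" for k
    using legendre_rec_minus[of ?d "2 * k" x] by (simp add: abs_if)
  have "(?d - 1) * (?L (2 * l) \<bar>x\<bar> - ?L (2 * (l + 1)) \<bar>x\<bar>) \<le> (4 * real l + ?d) * (1 - x\<^sup>2)"
    using legendre_rec_diff_bound[OF assms(1), of "2 * l" "\<bar>x\<bar>"] assms by auto
  then have "?L (2 * l) x - ?L (2 * (l + 1)) x \<le> (4 * real l + ?d) * (1 - x\<^sup>2) / (?d - 1)"
    unfolding even using d by (simp add: pos_le_divide_eq mult.commute)
  also have "\<dots> = (8 * real l + 2 * ?d) / (2 * ?d) * (1 - ?L 2 x)"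
  proof -
    \<comment> \<open>From P_2 = (d x^2 - 1) / (d - 1).\<close>
    have "1 - ?L 2 x = ?d / (?d - 1) * (1 - x\<^sup>2)"
      using d by (simp add: numeral_2_eq_2 divide_simps power2_eq_square algebra_simps)
    then show ?thesis using d by (simp only:) (simp add: divide_simps, simp add: algebra_simps)
  qed
  also have "8 * real l + 2 * ?d
      = sphere_eigenvalue CARD('n) (2 * (l + 1)) - sphere_eigenvalue CARD('n) (2 * l)"
    by (simp add: sphere_eigenvalue_def algebra_simps)
  also have "2 * ?d = sphere_eigenvalue CARD('n) 2"
    by (simp add: sphere_eigenvalue_def)
  finally show ?thesis by (simp only: legendre_poly_eq[OF assms(1)])
qed

end
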